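(* (Riesz representation theorem) Let $Y$ be a Hilbert $\mathbb{H}$-bimodule with $\mathbb{H}$-valued inner product $\langle\cdot,\cdot\rangle$. Then for any $T\in Y^r$ there exists a unique $y\in Y$ such that $$m(T(x))=\langle y,x\rangle\qquad (x\in Y)$$ and $\|T\|_L=\|y\|$.
   Context: $\mathbb{H}$ denotes the real quaternions with conjugation $^*$ and the Euclidean norm; $\mathbb{R}$ is identified with its center and $\otimes$ is the algebraic tensor product over $\mathbb{R}$. An $\mathbb{H}$-vector space is a unital $\mathbb{H}$-bimodule $X$ with $rx=xr$ for $r\in\mathbb{R}$; an $\mathbb{H}$-normed space is an $\mathbb{H}$-vector space with a norm satisfying $\|\alpha x\beta\|\le\|\alpha\|\|x\|\|\beta\|$. An $\mathbb{H}$-valued inner product on a right $\mathbb{H}$-module $Y$ is a map $\langle\cdot,\cdot\rangle:Y\times Y\to\mathbb{H}$ with $\langle x,y+z\beta\rangle=\langle x,y\rangle+\langle x,z\rangle\beta$, $\langle y,x\rangle=\langle x,y\rangle^*$, $\langle x,x\rangle\ge0$, and $\langle x,x\rangle=0$ implies $x=0$. A Hilbert $\mathbb{H}$-bimodule is an $\mathbb{H}$-vector space $Y$ with an $\mathbb{H}$-valued inner product (for its right module structure) such that $\langle\alpha x,y\rangle=\langle x,\alpha^*y\rangle$ for $x,y\in Y$, $\alpha\in\mathbb{H}$, and which is complete under $\|y\|=\sqrt{\|\langle y,y\rangle\|}$. For an $\mathbb{H}$-normed space $X$, $X^r$ is the space of bounded $\mathbb{H}$-bimodule maps from $X$ to $\mathbb{H}\otimes\mathbb{H}$,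 where $\mathbb{H}\otimes\mathbb{H}$ carries the injective tensor norm and the bimodule structure $\alpha(a\otimes b)\beta=a\otimes\alpha b\beta$. $m:\mathbb{H}\otimes\mathbb{H}\to\mathbb{H}$ is the multiplication map $a\otimes b\mapsto ab$, and $\|T\|_L:=\|m\circ T\|$ (operator norm of the $\mathbb{R}$-linear map $m\circ T:X\to\mathbb{H}$) for $T\in X^r$. *)

theory Defs
  imports "HOL-Analysis.Analysis" "HOL-Library.Poly_Mapping"
begin

section \<open>Quaternions\<close>

datatype quat = Quat (qRe: real) (qI: real) (qJ: real) (qK: real)

lemma quat_eq_iff:
  "x = y \<longleftrightarrow> qRe x = qRe y \<and> qI x = qI y \<and> qJ x = qJ y \<and> qK x = qK y"
  by (cases x; cases y) simp

instantiation quat :: real_algebra_1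
begin

definition "0 = Quat 0 0 0 0"

definition "1 = Quat 1 0 0 0"

definition "x + y = Quat (qRe x + qRe y) (qI x + qI y) (qJ x + qJ y) (qK x + qK y)"

definition "- x = Quat (- qRe x) (- qI x) (- qJ x) (- qK x)"

definition "x - y = Quat (qRe x - qRe y) (qI x - qI y) (qJ x - qJ y) (qK x - qK y)"

definition "r *\<^sub>R x = Quat (r * qRe x) (r * qI x) (r * qJ x) (r * qK x)"

definition "x * y = Quat
   (qRe x * qRe y - qI x * qI y - qJ x * qJ y - qK x * qK y)
   (qRe x * qI y + qI x * qRe y + qJ x * qK y - qK x * qJ y)
   (qRe x * qJ y - qI x * qK y + qJ x * qRe y + qK x * qI y)
   (qRe x * qK y + qI x * qJ y - qJ x * qI y + qK x * qRe y)"

instance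
  by standard
    (simp_all add: quat_eq_iff zero_quat_def one_quat_def plus_quat_def uminus_quat_def
      minus_quat_def scaleR_quat_def times_quat_def algebra_simps)

end

lemma quat_sel_simps [simp]:
  "qRe 0 = 0" "qI 0 = 0" "qJ 0 = 0" "qK 0 = 0"
  "qRe 1 = 1" "qI 1 = 0" "qJ 1 = 0" "qK 1 = 0"
  "qRe (x + y) = qRe x + qRe y" "qI (x + y) = qI x + qI y"
  "qJ (x + y) = qJ x + qJ y" "qK (x + y) = qK x + qK y"
  "qRe (- x) = - qRe x" "qI (- x) = - qI x" "qJ (- x) = - qJ x" "qK (- x) = - qK x"
  "qRe (x - y) = qRe x - qRe y" "qI (x - y) = qI x - qI y"
  "qJ (x - y) = qJ x - qJ y" "qK (x - y) = qK x - qK y"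
  "qRe (r *\<^sub>R x) = r * qRe x" "qI (r *\<^sub>R x) = r * qI x"
  "qJ (r *\<^sub>R x) = r * qJ x" "qK (r *\<^sub>R x) = r * qK x"
  by (simp_all add: zero_quat_def one_quat_def plus_quat_def uminus_quat_def
      minus_quat_def scaleR_quat_def)

lemma quat_times_sel:
  "qRe (x * y) = qRe x * qRe y - qI x * qI y - qJ x * qJ y - qK x * qK y"
  "qI (x * y) = qRe x * qI y + qI x * qRe y + qJ x * qK y - qK x * qJ y"
  "qJ (x * y) = qRe x * qJ y - qI x * qK y + qJ x * qRe y + qK x * qI y"
  "qK (x * y) = qRe x * qK y + qI x * qJ y - qJ x * qI y + qK x * qRe y"
  by (simp_all add: times_quat_def)

lemma quat_of_real_sel [simp]:
  "qRe (of_real r) = r" "qI (of_real r) = 0" "qJ (of_real r) = 0" "qK (of_real r) = 0"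
  by (simp_all add: of_real_def)

definition qcnj :: "quat \<Rightarrow> quat"
  where "qcnj x = Quat (qRe x) (- qI x) (- qJ x) (- qK x)"

lemma qcnj_sel [simp]:
  "qRe (qcnj x) = qRe x" "qI (qcnj x) = - qI x" "qJ (qcnj x) = - qJ x" "qK (qcnj x) = - qK x"
  by (simp_all add: qcnj_def)

text \<open>The inner product below is the real Euclidean one; it induces the Euclidean norm.\<close>

instantiation quat :: real_inner
begin

definition "inner x y = qRe x * qRe y + qI x * qI y + qJ x * qJ y + qK x * qK y"

definition "norm (x :: quat) = sqrt ((qRe x)\<^sup>2 + (qI x)\<^sup>2 + (qJ x)\<^sup>2 + (qK x)\<^sup>2)"

definition "sgn (x :: quat) = x /\<^sub>R norm x"

definition "dist (x :: quat) y = norm (x - y)"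

definition
  "(uniformity :: (quat \<times> quat) filter) = (INF e\<in>{0 <..}. principal {(x, y). dist x y < e})"

definition
  "open (U :: quat set) \<longleftrightarrow> (\<forall>x\<in>U. eventually (\<lambda>(x', y). x' = x \<longrightarrow> y \<in> U) uniformity)"

instance
proof
  fix x y z :: quat and r :: real and U :: "quat set"
  show "sgn x = x /\<^sub>R norm x" by (rule sgn_quat_def)
  show "dist x y = norm (x - y)" by (rule dist_quat_def)
  show "(uniformity :: (quat \<times> quat) filter) = (INF e\<in>{0 <..}. principal {(x, y). dist x y < e})"
    by (rule uniformity_quat_def)
  show "open U \<longleftrightarrow> (\<forall>x\<in>U. eventually (\<lambda>(x', y). x' = x \<longrightarrow> y \<in> U) uniformity)"
    by (rule open_quat_def)
  show "inner x y = inner y x" "inner (x + y) z = inner x z + inner y z"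
    "inner (r *\<^sub>R x) y = r * inner x y" "0 \<le> inner x x"
    by (simp_all add: inner_quat_def algebra_simps)
  have "qRe x = 0 \<and> qI x = 0 \<and> qJ x = 0 \<and> qK x = 0" if "inner x x = 0"
    using that unfolding inner_quat_def
    by (smt (verit) mult_eq_0_iff zero_le_square)
  then show "inner x x = 0 \<longleftrightarrow> x = 0"
    by (auto simp: quat_eq_iff) (simp add: inner_quat_def)
  show "norm x = sqrt (inner x x)"
    by (simp add: inner_quat_def norm_quat_def power2_eq_square)
qed

end

lemma qcnj_mult_self: "qcnj x * x = of_real ((norm x)\<^sup>2)" "x * qcnj x = of_real ((norm x)\<^sup>2)"
  by (simp_all add: quat_eq_iff quat_times_sel norm_quat_def power2_eq_square)

instantiation quat :: real_normed_div_algebra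
begin

definition "inverse (x :: quat) = qcnj x /\<^sub>R (norm x)\<^sup>2"

definition "x div (y :: quat) = x * inverse y"

instance
proof
  fix x y :: quat
  show "x \<noteq> 0 \<Longrightarrow> inverse x * x = 1" "x \<noteq> 0 \<Longrightarrow> x * inverse x = 1"
    by (simp_all only: inverse_quat_def mult_scaleR_left mult_scaleR_right qcnj_mult_self)
      (simp_all add: quat_eq_iff del: of_real_power)
  show "x div y = x * inverse y" by (rule divide_quat_def)
  show "inverse (0 :: quat) = 0" by (simp add: inverse_quat_def quat_eq_iff)
  show "norm (x * y) = norm x * norm y"
    unfolding norm_quat_def real_sqrt_mult[symmetric] quat_times_sel
    by (rule arg_cong[where f = sqrt]) algebra
qed

end


section \<open>Quaternionic bimodules\<close>

text \<open>The real structure of an \<open>\<bbbH>\<close>-vector space is the one underlying \<^class>\<open>real_vector\<close>; the two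
  axioms on \<^const>\<open>of_real\<close> say that it is induced by either action, i.e. \<open>r x = x r\<close>.\<close>

class h_vector_space = real_vector +
  fixes lact :: "quat \<Rightarrow> 'a \<Rightarrow> 'a"  (infixr \<open>\<rhd>\<close> 76)
    and ract :: "'a \<Rightarrow> quat \<Rightarrow> 'a"  (infixl \<open>\<lhd>\<close> 75)
  assumes lact_add_right: "\<alpha> \<rhd> (x + y) = (\<alpha> \<rhd> x) + (\<alpha> \<rhd> y)"
    and lact_add_left: "(\<alpha> + \<beta>) \<rhd> x = (\<alpha> \<rhd> x) + (\<beta> \<rhd> x)"
    and lact_lact: "\<alpha> \<rhd> (\<beta> \<rhd> x) = (\<alpha> * \<beta>) \<rhd> x"
    and ract_add_left: "(x + y) \<lhd> \<alpha> = (x \<lhd> \<alpha>) + (y \<lhd> \<alpha>)"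
    and ract_add_right: "x \<lhd> (\<alpha> + \<beta>) = (x \<lhd> \<alpha>) + (x \<lhd> \<beta>)"
    and ract_ract: "(x \<lhd> \<alpha>) \<lhd> \<beta> = x \<lhd> (\<alpha> * \<beta>)"
    and lact_ract: "(\<alpha> \<rhd> x) \<lhd> \<beta> = \<alpha> \<rhd> (x \<lhd> \<beta>)"
    and lact_of_real: "of_real r \<rhd> x = r *\<^sub>R x"
    and ract_of_real: "x \<lhd> of_real r = r *\<^sub>R x"
begin

lemma lact_one [simp]: "1 \<rhd> x = x"
  using lact_of_real[of 1 x] by (simp add: scaleR_one)

lemma ract_one [simp]: "x \<lhd> 1 = x"
  using ract_of_real[of x 1] by (simp add: scaleR_one)

end

lemma linear_lact: "linear ((\<rhd>) \<alpha> :: 'a::h_vector_space \<Rightarrow> 'a)"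
proof
  fix r :: real and x :: 'a
  have "\<alpha> * of_real r = of_real r * \<alpha>"
    by (simp add: quat_eq_iff quat_times_sel)
  then show "\<alpha> \<rhd> (r *\<^sub>R x) = r *\<^sub>R (\<alpha> \<rhd> x)"
    by (metis lact_lact lact_of_real)
qed (rule lact_add_right)

lemma linear_ract: "linear (\<lambda>x :: 'a::h_vector_space. x \<lhd> \<alpha>)"
proof
  fix r :: real and x :: 'a
  show "(r *\<^sub>R x) \<lhd> \<alpha> = r *\<^sub>R (x \<lhd> \<alpha>)"
    by (metis lact_of_real lact_ract)
qed (rule ract_add_left)

instantiation quat :: h_vector_space
begin

definition "\<alpha> \<rhd> x = \<alpha> * (x :: quat)"

definition "x \<lhd> \<alpha> = (x :: quat) * \<alpha>"

instance
  by standard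
    (simp_all add: lact_quat_def ract_quat_def distrib_left distrib_right mult.assoc
      scaleR_conv_of_real, simp add: quat_eq_iff quat_times_sel)

end

class h_normed_space = h_vector_space + real_normed_vector +
  assumes norm_act_le: "norm (\<alpha> \<rhd> x \<lhd> \<beta>) \<le> norm \<alpha> * norm x * norm \<beta>"

text \<open>\<^const>\<open>nonneg_Reals\<close> is taken in \<^typ>\<open>quat\<close>: positivity of the inner product says that
  \<open>\<langle>x, x\<rangle>\<close> is a non-negative real quaternion. Building on \<^class>\<open>real_normed_vector\<close> gives access to the
  library's norm and metric; it is no extra hypothesis, as the norm axioms follow from those of the
  inner product and \<open>norm_eq_sqrt_hinner\<close> by the Cauchy--Schwarz inequality.\<close>

class h_inner_space = h_vector_space + real_normed_vector +
  fixes hinner :: "'a \<Rightarrow> 'a \<Rightarrow> quat"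
  assumes hinner_add_right: "hinner x (y + z) = hinner x y + hinner x z"
    and hinner_ract: "hinner x (z \<lhd> \<beta>) = hinner x z * \<beta>"
    and hinner_commute: "hinner y x = qcnj (hinner x y)"
    and hinner_nonneg: "hinner x x \<in> \<real>\<^sub>\<ge>\<^sub>0"
    and hinner_definite: "hinner x x = 0 \<Longrightarrow> x = 0"
    and hinner_lact: "hinner (\<alpha> \<rhd> x) y = hinner x (qcnj \<alpha> \<rhd> y)"
    and norm_eq_sqrt_hinner: "norm y = sqrt (norm (hinner y y))"
begin

lemma hinner_scaleR_right: "hinner x (r *\<^sub>R y) = r *\<^sub>R hinner x y"
  using hinner_ract[of x y "of_real r"]
  by (simp add: ract_of_real quat_eq_iff quat_times_sel)

lemma hinner_self: "hinner x x = of_real ((norm x)\<^sup>2)"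
  using hinner_nonneg[of x] by (auto simp: nonneg_Reals_def norm_eq_sqrt_hinner)

subclass h_normed_space
proof
  fix \<alpha> \<beta> :: quat and x :: 'a
  have norm_eqI: "norm z = c" if "hinner z z = of_real (c\<^sup>2)" "0 \<le> c" for z :: 'a and c
    using that by (simp add: norm_eq_sqrt_hinner[of z] norm_power)
  have 1: "norm (\<alpha> \<rhd> x) = norm \<alpha> * norm x" for x
  proof (rule norm_eqI)
    have "hinner (\<alpha> \<rhd> x) (\<alpha> \<rhd> x) = (norm \<alpha>)\<^sup>2 *\<^sub>R hinner x x"
      by (simp only: hinner_lact lact_lact qcnj_mult_self lact_of_real hinner_scaleR_right)
    then show "hinner (\<alpha> \<rhd> x) (\<alpha> \<rhd> x) = of_real ((norm \<alpha> * norm x)\<^sup>2)"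
      by (simp add: hinner_self power_mult_distrib scaleR_conv_of_real)
  qed simp
  have 2: "norm (x \<lhd> \<beta>) = norm x * norm \<beta>" for x
  proof (rule norm_eqI)
    have "hinner (x \<lhd> \<beta>) x = qcnj (hinner x x * \<beta>)"
      by (simp only: hinner_commute[of "x \<lhd> \<beta>" x] hinner_ract)
    then have "hinner (x \<lhd> \<beta>) (x \<lhd> \<beta>) = qcnj (of_real ((norm x)\<^sup>2) * \<beta>) * \<beta>"
      by (simp only: hinner_ract hinner_self[of x])
    also have "\<dots> = qcnj ((norm x)\<^sup>2 *\<^sub>R \<beta>) * \<beta>"
      by (simp only: scaleR_conv_of_real)
    also have "\<dots> = (norm x)\<^sup>2 *\<^sub>R (qcnj \<beta> * \<beta>)"
      by (simp add: quat_eq_iff quat_times_sel algebra_simps)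
    finally show "hinner (x \<lhd> \<beta>) (x \<lhd> \<beta>) = of_real ((norm x * norm \<beta>)\<^sup>2)"
      by (simp add: qcnj_mult_self power_mult_distrib scaleR_conv_of_real)
  qed simp
  show "norm (\<alpha> \<rhd> x \<lhd> \<beta>) \<le> norm \<alpha> * norm x * norm \<beta>"
    by (simp add: 1 2)
qed

end

class hilbert_h_bimodule = h_inner_space + complete_space


section \<open>The algebraic tensor product over the reals\<close>

instantiation poly_mapping :: (type, real_vector) real_vector
begin

definition "r *\<^sub>R p = Poly_Mapping.map (scaleR r) p"

lemma lookup_scaleR [simp]: "Poly_Mapping.lookup (r *\<^sub>R p) x = r *\<^sub>R Poly_Mapping.lookup p x"
  by (simp add: scaleR_poly_mapping_def Poly_Mapping.map.rep_eq when_def)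

instance
  by standard (simp_all add: poly_mapping_eq_iff fun_eq_iff lookup_add scaleR_add_left scaleR_add_right)

end

text \<open>\<open>A \<otimes> B\<close> is the free real vector space on \<open>A \<times> B\<close> modulo the span of the bilinearity relations.\<close>

abbreviation formal_tensor :: "'a \<Rightarrow> 'b \<Rightarrow> ('a \<times> 'b) \<Rightarrow>\<^sub>0 real"
  where "formal_tensor a b \<equiv> Poly_Mapping.single (a, b) 1"

definition tensor_null :: "(('a::real_vector \<times> 'b::real_vector) \<Rightarrow>\<^sub>0 real) set"
  where "tensor_null = span
    ({formal_tensor (a + a') b - formal_tensor a b - formal_tensor a' b | a a' b. True} \<union>
     {formal_tensor a (b + b') - formal_tensor a b - formal_tensor a b' | a b b'. True} \<union>
     {formal_tensor (r *\<^sub>R a) b - r *\<^sub>R formal_tensor a b | r a b. True} \<union>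
     {formal_tensor a (r *\<^sub>R b) - r *\<^sub>R formal_tensor a b | r a b. True})"

lemma subspace_tensor_null: "subspace tensor_null"
  by (simp add: tensor_null_def)

definition tensor_rel :: "(('a::real_vector \<times> 'b::real_vector) \<Rightarrow>\<^sub>0 real) \<Rightarrow> (('a \<times> 'b) \<Rightarrow>\<^sub>0 real) \<Rightarrow> bool"
  where "tensor_rel p q \<longleftrightarrow> p - q \<in> tensor_null"

lemma equivp_tensor_rel:
  "equivp (tensor_rel :: (('a::real_vector \<times> 'b::real_vector) \<Rightarrow>\<^sub>0 real) \<Rightarrow> _)"
proof (rule equivpI)
  note sub = subspace_tensor_null
  show "reflp (tensor_rel :: (('a \<times> 'b) \<Rightarrow>\<^sub>0 real) \<Rightarrow> _)"
    by (simp add: reflp_def tensor_rel_def subspace_0[OF sub])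
  show "symp (tensor_rel :: (('a \<times> 'b) \<Rightarrow>\<^sub>0 real) \<Rightarrow> _)"
    unfolding symp_def tensor_rel_def using subspace_neg[OF sub] by (metis minus_diff_eq)
  show "transp (tensor_rel :: (('a \<times> 'b) \<Rightarrow>\<^sub>0 real) \<Rightarrow> _)"
  proof (rule transpI)
    fix p q r :: "('a \<times> 'b) \<Rightarrow>\<^sub>0 real"
    assume "tensor_rel p q" "tensor_rel q r"
    then have "(p - q) + (q - r) \<in> tensor_null"
      unfolding tensor_rel_def by (rule subspace_add[OF sub])
    then show "tensor_rel p r"
      by (simp add: tensor_rel_def)
  qed
qed

quotient_type (overloaded) ('a, 'b) tensor =
  "('a::real_vector \<times> 'b::real_vector) \<Rightarrow>\<^sub>0 real" / tensor_rel
  by (rule equivp_tensor_rel)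

instantiation tensor :: (real_vector, real_vector) real_vector
begin

lift_definition zero_tensor :: "('a, 'b) tensor" is 0 .

lift_definition plus_tensor :: "('a, 'b) tensor \<Rightarrow> ('a, 'b) tensor \<Rightarrow> ('a, 'b) tensor" is "(+)"
proof -
  fix p q p' q' :: "('a \<times> 'b) \<Rightarrow>\<^sub>0 real"
  assume "tensor_rel p q" "tensor_rel p' q'"
  then have "(p - q) + (p' - q') \<in> tensor_null"
    unfolding tensor_rel_def by (rule subspace_add[OF subspace_tensor_null])
  then show "tensor_rel (p + p') (q + q')"
    unfolding tensor_rel_def by (simp add: algebra_simps)
qed

lift_definition uminus_tensor :: "('a, 'b) tensor \<Rightarrow> ('a, 'b) tensor" is uminus
proof -
  fix p q :: "('a \<times> 'b) \<Rightarrow>\<^sub>0 real"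
  assume "tensor_rel p q"
  then have "- (p - q) \<in> tensor_null"
    unfolding tensor_rel_def by (rule subspace_neg[OF subspace_tensor_null])
  then show "tensor_rel (- p) (- q)"
    unfolding tensor_rel_def by (simp add: algebra_simps)
qed

lift_definition minus_tensor :: "('a, 'b) tensor \<Rightarrow> ('a, 'b) tensor \<Rightarrow> ('a, 'b) tensor" is "(-)"
proof -
  fix p q p' q' :: "('a \<times> 'b) \<Rightarrow>\<^sub>0 real"
  assume "tensor_rel p q" "tensor_rel p' q'"
  then have "(p - q) - (p' - q') \<in> tensor_null"
    unfolding tensor_rel_def by (rule subspace_diff[OF subspace_tensor_null])
  then show "tensor_rel (p - p') (q - q')"
    unfolding tensor_rel_def by (simp add: algebra_simps)
qed

lift_definition scaleR_tensor :: "real \<Rightarrow> ('a, 'b) tensor \<Rightarrow> ('a, 'b) tensor" is scaleR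
  unfolding tensor_rel_def scaleR_diff_right[symmetric]
  by (rule subspace_scale[OF subspace_tensor_null])

instance
proof -
  have refl: "tensor_rel p p" for p :: "('a \<times> 'b) \<Rightarrow>\<^sub>0 real"
    by (simp add: tensor_rel_def subspace_0[OF subspace_tensor_null])
  show "OFCLASS(('a, 'b) tensor, real_vector_class)"
    by standard (transfer; simp add: algebra_simps refl)+
qed

end

lift_definition tensor :: "'a::real_vector \<Rightarrow> 'b::real_vector \<Rightarrow> ('a, 'b) tensor"  (infixl \<open>\<otimes>\<close> 70)
  is formal_tensor .

lemma bilinear_tensor: "bilinear (\<otimes>)"
proof -
  have "(a + a') \<otimes> b = a \<otimes> b + a' \<otimes> b" "a \<otimes> (b + b') = a \<otimes> b + a \<otimes> b'"
    "(r *\<^sub>R a) \<otimes> b = r *\<^sub>R (a \<otimes> b)" "a \<otimes> (r *\<^sub>R b) = r *\<^sub>R (a \<otimes> b)"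
    for a a' :: 'a and b b' :: 'b and r
    by (transfer, unfold tensor_rel_def tensor_null_def diff_diff_eq[symmetric],
        rule span_base, blast)+
  then show ?thesis
    by (simp add: bilinear_def linear_iff)
qed

text \<open>For bilinear \<open>f\<close>, \<open>tensor_lift f\<close> is the linear map with \<open>a \<otimes> b \<mapsto> f a b\<close>; it is only used for
  such \<open>f\<close>, where the choice of representative is irrelevant.\<close>

definition formal_lift :: "('a \<Rightarrow> 'b \<Rightarrow> 'c::real_vector) \<Rightarrow> (('a \<times> 'b) \<Rightarrow>\<^sub>0 real) \<Rightarrow> 'c"
  where "formal_lift f p = (\<Sum>(a, b)\<in>Poly_Mapping.keys p. Poly_Mapping.lookup p (a, b) *\<^sub>R f a b)"

definition tensor_lift ::
    "('a::real_vector \<Rightarrow> 'b::real_vector \<Rightarrow> 'c::real_vector) \<Rightarrow> ('a, 'b) tensor \<Rightarrow> 'c"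
  where "tensor_lift f t = formal_lift f (rep_tensor t)"

lemma formal_lift_superset:
  assumes "finite S" "Poly_Mapping.keys p \<subseteq> S"
  shows "formal_lift f p = (\<Sum>(a, b)\<in>S. Poly_Mapping.lookup p (a, b) *\<^sub>R f a b)"
  unfolding formal_lift_def
  by (rule sum.mono_neutral_left) (use assms in \<open>auto simp: in_keys_iff\<close>)

lemma linear_formal_lift: "linear (formal_lift f)"
proof
  fix p q :: "('a \<times> 'b) \<Rightarrow>\<^sub>0 real" and r :: real
  let ?S = "Poly_Mapping.keys p \<union> Poly_Mapping.keys q"
  have S: "finite ?S" "Poly_Mapping.keys p \<subseteq> ?S" "Poly_Mapping.keys q \<subseteq> ?S"
    "Poly_Mapping.keys (p + q) \<subseteq> ?S" "Poly_Mapping.keys (r *\<^sub>R p) \<subseteq> ?S"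
    using keys_add[of p q] by (auto simp: in_keys_iff)
  show "formal_lift f (p + q) = formal_lift f p + formal_lift f q"
    by (simp add: formal_lift_superset[OF S(1) S(2)] formal_lift_superset[OF S(1) S(3)]
        formal_lift_superset[OF S(1) S(4)] lookup_add scaleR_add_left sum.distrib case_prod_beta)
  show "formal_lift f (r *\<^sub>R p) = r *\<^sub>R formal_lift f p"
    by (simp add: formal_lift_superset[OF S(1) S(2)] formal_lift_superset[OF S(1) S(5)]
        scaleR_sum_right case_prod_beta)
qed

lemma formal_lift_formal_tensor: "formal_lift f (formal_tensor a b) = f a b"
  by (simp add: formal_lift_def)

lemma formal_lift_null:
  assumes "bilinear f" "p \<in> tensor_null"
  shows "formal_lift f p = 0"
proof -
  note L = linear_formal_lift[of f]
  show ?thesis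
    using assms(2) unfolding tensor_null_def
    by (rule linear_eq_0_on_span[OF L, rotated])
      (use assms(1) in \<open>auto simp: linear_diff[OF L] linear_scale[OF L] formal_lift_formal_tensor
        bilinear_ladd bilinear_radd bilinear_lmul bilinear_rmul\<close>)
qed

lemma tensor_lift_abs:
  assumes "bilinear f"
  shows "tensor_lift f (abs_tensor p) = formal_lift f p"
proof -
  have "rep_tensor (abs_tensor p) - p \<in> tensor_null"
    using Quotient3_rep_abs[OF Quotient3_tensor, OF equivp_reflp[OF equivp_tensor_rel]]
    by (simp only: tensor_rel_def)
  then show ?thesis
    using formal_lift_null[OF assms] linear_diff[OF linear_formal_lift]
    by (metis eq_iff_diff_eq_0 tensor_lift_def)
qed

lemma tensor_lift_tensor [simp]: "bilinear f \<Longrightarrow> tensor_lift f (a \<otimes> b) = f a b"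
  by (simp add: tensor.abs_eq tensor_lift_abs formal_lift_formal_tensor)

lemma linear_tensor_lift:
  assumes "bilinear f"
  shows "linear (tensor_lift f)"
proof
  fix s t :: "('a, 'b) tensor" and r :: real
  obtain p q where "s = abs_tensor p" "t = abs_tensor q"
    using Quotient3_abs_rep[OF Quotient3_tensor] by metis
  then show "tensor_lift f (s + t) = tensor_lift f s + tensor_lift f t"
    "tensor_lift f (r *\<^sub>R s) = r *\<^sub>R tensor_lift f s"
    by (simp_all add: plus_tensor.abs_eq scaleR_tensor.abs_eq tensor_lift_abs[OF assms]
        linear_add[OF linear_formal_lift] linear_scale[OF linear_formal_lift])
qed

lemma tensor_linear_eqI:
  assumes "linear F" "linear G" "\<And>a b. F (a \<otimes> b) = G (a \<otimes> b)"
  shows "F t = G t"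
proof -
  have "F (abs_tensor p) = G (abs_tensor p)" for p
  proof (induction p rule: Poly_Mapping.update_induct)
    case const
    then show ?case
      using assms by (simp add: zero_tensor.abs_eq[symmetric] linear_0)
  next
    case (update p k v)
    have "Poly_Mapping.update k v p = v *\<^sub>R Poly_Mapping.single k 1 + p"
      using update.hyps
      by (auto simp: poly_mapping_eq_iff fun_eq_iff lookup_single lookup_add
          Poly_Mapping.lookup_update when_def in_keys_iff)
    then have "abs_tensor (Poly_Mapping.update k v p) = v *\<^sub>R (fst k \<otimes> snd k) + abs_tensor p"
      by (simp add: tensor.abs_eq scaleR_tensor.abs_eq plus_tensor.abs_eq)
    then show ?case
      using assms update.IH by (simp add: linear_add linear_scale)
  qed
  then show ?thesis
    using Quotient3_abs_rep[OF Quotient3_tensor, of t] by metis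
qed

text \<open>The bimodule structure \<open>\<alpha>(a \<otimes> b)\<beta> = a \<otimes> \<alpha>b\<beta>\<close> acts on the second factor only.\<close>

instantiation tensor :: (real_vector, h_vector_space) h_vector_space
begin

definition "\<alpha> \<rhd> t = tensor_lift (\<lambda>a b. a \<otimes> (\<alpha> \<rhd> b)) t" for t :: "('a, 'b) tensor"

definition "t \<lhd> \<alpha> = tensor_lift (\<lambda>a b. a \<otimes> (b \<lhd> \<alpha>)) t" for t :: "('a, 'b) tensor"

instance
proof
  fix \<alpha> \<beta> :: quat and s t :: "('a, 'b) tensor" and r :: real
  note T [simp] = bilinear_ladd[OF bilinear_tensor] bilinear_radd[OF bilinear_tensor]
    bilinear_lmul[OF bilinear_tensor] bilinear_rmul[OF bilinear_tensor]
  note [simp] = linear_add[OF linear_lact] linear_scale[OF linear_lact]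
    linear_add[OF linear_ract] linear_scale[OF linear_ract]
  have bl: "bilinear (\<lambda>(a :: 'a) (b :: 'b). a \<otimes> (\<alpha> \<rhd> b))"
    and br: "bilinear (\<lambda>(a :: 'a) (b :: 'b). a \<otimes> (b \<lhd> \<alpha>))" for \<alpha>
    by (simp_all add: bilinear_def linear_iff)
  have ll: "linear (\<lambda>t :: ('a, 'b) tensor. \<alpha> \<rhd> t)"
    and lr: "linear (\<lambda>t :: ('a, 'b) tensor. t \<lhd> \<alpha>)" for \<alpha>
    using linear_tensor_lift[OF bl] linear_tensor_lift[OF br]
    by (simp_all add: lact_tensor_def[abs_def] ract_tensor_def[abs_def])
  have tl: "\<alpha> \<rhd> (a \<otimes> b) = a \<otimes> (\<alpha> \<rhd> b)" and tr: "(a \<otimes> b) \<lhd> \<alpha> = a \<otimes> (b \<lhd> \<alpha>)"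
    for \<alpha> and a :: 'a and b :: 'b
    using bl br by (simp_all add: lact_tensor_def ract_tensor_def)
  note comp = linear_compose[unfolded o_def]
  show "\<alpha> \<rhd> (s + t) = (\<alpha> \<rhd> s) + (\<alpha> \<rhd> t)" by (rule linear_add[OF ll])
  show "(s + t) \<lhd> \<alpha> = (s \<lhd> \<alpha>) + (t \<lhd> \<alpha>)" by (rule linear_add[OF lr])
  show "(\<alpha> + \<beta>) \<rhd> t = (\<alpha> \<rhd> t) + (\<beta> \<rhd> t)"
    by (rule tensor_linear_eqI[where t = t])
      (simp_all add: ll linear_compose_add tl lact_add_left)
  show "t \<lhd> (\<alpha> + \<beta>) = (t \<lhd> \<alpha>) + (t \<lhd> \<beta>)"
    by (rule tensor_linear_eqI[where t = t])
      (simp_all add: lr linear_compose_add tr ract_add_right)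
  show "\<alpha> \<rhd> (\<beta> \<rhd> t) = (\<alpha> * \<beta>) \<rhd> t"
    by (rule tensor_linear_eqI[where t = t]) (simp_all add: ll comp[OF ll ll] tl lact_lact)
  show "(t \<lhd> \<alpha>) \<lhd> \<beta> = t \<lhd> (\<alpha> * \<beta>)"
    by (rule tensor_linear_eqI[where t = t]) (simp_all add: lr comp[OF lr lr] tr ract_ract)
  show "(\<alpha> \<rhd> t) \<lhd> \<beta> = \<alpha> \<rhd> (t \<lhd> \<beta>)"
    by (rule tensor_linear_eqI[where t = t])
      (simp_all add: comp[OF ll lr] comp[OF lr ll] tl tr lact_ract)
  show "of_real r \<rhd> t = r *\<^sub>R t"
    by (rule tensor_linear_eqI[where t = t]) (simp_all add: ll tl lact_of_real)
  show "t \<lhd> of_real r = r *\<^sub>R t"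
    by (rule tensor_linear_eqI[where t = t]) (simp_all add: lr tr ract_of_real)
qed

end

lemma lact_tensor [simp]: "\<alpha> \<rhd> (a \<otimes> b) = a \<otimes> (\<alpha> \<rhd> b)"
  and ract_tensor [simp]: "(a \<otimes> b) \<lhd> \<alpha> = a \<otimes> (b \<lhd> \<alpha>)"
  unfolding lact_tensor_def ract_tensor_def
  by (rule tensor_lift_tensor;
      simp add: bilinear_def linear_iff bilinear_ladd[OF bilinear_tensor]
        bilinear_radd[OF bilinear_tensor] bilinear_lmul[OF bilinear_tensor]
        bilinear_rmul[OF bilinear_tensor] linear_add[OF linear_lact] linear_scale[OF linear_lact]
        linear_add[OF linear_ract] linear_scale[OF linear_ract])+

text \<open>Injective tensor norm: the supremum of \<open>\<bar>(\<phi> \<otimes> \<psi>)(t)\<bar>\<close> over the closed unit balls of the real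
  dual spaces.\<close>

definition inj_norm :: "('a::real_normed_vector, 'b::real_normed_vector) tensor \<Rightarrow> real"
  where "inj_norm t = Sup {\<bar>tensor_lift (\<lambda>a b. blinfun_apply \<phi> a * blinfun_apply \<psi> b) t\<bar> | \<phi> \<psi>.
    norm (\<phi> :: 'a \<Rightarrow>\<^sub>L real) \<le> 1 \<and> norm (\<psi> :: 'b \<Rightarrow>\<^sub>L real) \<le> 1}"

lemma bilinear_blinfun_mult: "bilinear (\<lambda>a b. blinfun_apply \<phi> a * blinfun_apply \<psi> b :: real)"
  by (simp add: bilinear_def linear_iff blinfun.add_right blinfun.scaleR_right algebra_simps)

lemma bdd_above_inj_norm:
  fixes t :: "('a::real_normed_vector, 'b::real_normed_vector) tensor"
  shows "bdd_above {\<bar>tensor_lift (\<lambda>a b. blinfun_apply \<phi> a * blinfun_apply \<psi> b) t\<bar> | \<phi> \<psi>.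
    norm (\<phi> :: 'a \<Rightarrow>\<^sub>L real) \<le> 1 \<and> norm (\<psi> :: 'b \<Rightarrow>\<^sub>L real) \<le> 1}"
proof (rule bdd_aboveI, clarify)
  fix \<phi> :: "'a \<Rightarrow>\<^sub>L real" and \<psi> :: "'b \<Rightarrow>\<^sub>L real"
  assume le: "norm \<phi> \<le> 1" "norm \<psi> \<le> 1"
  let ?p = "rep_tensor t"
  have bound: "\<bar>blinfun_apply \<phi> a * blinfun_apply \<psi> b\<bar> \<le> norm a * norm b" for a b
  proof -
    have "norm (blinfun_apply \<phi> a) \<le> norm a" "norm (blinfun_apply \<psi> b) \<le> norm b"
      using norm_blinfun[of \<phi> a] norm_blinfun[of \<psi> b] le
      by (meson mult_left_le_one_le norm_ge_zero order_trans)+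
    then show ?thesis by (simp add: abs_mult mult_mono)
  qed
  show "\<bar>tensor_lift (\<lambda>a b. blinfun_apply \<phi> a * blinfun_apply \<psi> b) t\<bar>
    \<le> (\<Sum>(a, b)\<in>Poly_Mapping.keys ?p. \<bar>Poly_Mapping.lookup ?p (a, b)\<bar> * (norm a * norm b))"
    unfolding tensor_lift_def formal_lift_def
    by (rule order_trans[OF sum_abs], rule sum_mono)
      (auto simp: abs_mult mult_left_mono simp flip: abs_mult intro!: mult_left_mono bound,
        simp add: abs_mult mult_left_mono bound[unfolded abs_mult])
qed


section \<open>The dual \<open>X\<^sup>r\<close>\<close>

text \<open>Real linearity of a bimodule map is automatic, since the reals act through \<^typ>\<open>quat\<close>.\<close>

definition bimodule_map :: "('a::h_vector_space \<Rightarrow> 'b::h_vector_space) \<Rightarrow> bool"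
  where "bimodule_map T \<longleftrightarrow> (\<forall>x y. T (x + y) = T x + T y) \<and>
    (\<forall>\<alpha> x. T (\<alpha> \<rhd> x) = \<alpha> \<rhd> T x) \<and> (\<forall>x \<alpha>. T (x \<lhd> \<alpha>) = T x \<lhd> \<alpha>)"

definition r_dual :: "('x::h_normed_space \<Rightarrow> (quat, quat) tensor) set"
  where "r_dual = {T. bimodule_map T \<and> (\<exists>K. \<forall>x. inj_norm (T x) \<le> K * norm x)}"

definition mult_map :: "(quat, quat) tensor \<Rightarrow> quat"
  where "mult_map = tensor_lift (*)"

lemma mult_map_tensor [simp]: "mult_map (a \<otimes> b) = a * b"
  unfolding mult_map_def
  by (rule tensor_lift_tensor) (simp add: bilinear_def linear_iff distrib_left distrib_right)

definition L_norm :: "('x::h_normed_space \<Rightarrow> (quat, quat) tensor) \<Rightarrow> real"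
  where "L_norm T = onorm (mult_map \<circ> T)"

end

theory Submission
  imports Defs
begin

text \<open>
  The functional \<open>x \<mapsto> m (T x)\<close> is right \<open>\<bbbH>\<close>-linear, because \<open>\<beta>\<close> acts on \<open>a \<otimes> b\<close> from the right
  through \<open>b\<close>. Right \<open>\<bbbH>\<close>-linearity makes a quaternionic functional \<open>h\<close> recoverable from its real
  part, since \<open>qRe (h x * \<beta>) = qRe (h (x \<lhd> \<beta>))\<close> for every \<open>\<beta>\<close> (\<open>quat_eqI_qRe_mult\<close>). So it suffices
  to represent the real functional \<open>qRe (m (T x))\<close> with respect to the real inner product
  \<open>qRe \<langle>y, x\<rangle>\<close>.

  That is the Riesz theorem over the reals (\<open>real_riesz\<close>), proved by minimising the energy
  \<open>\<parallel>x\<parallel>\<^sup>2 / 2 - f x\<close>: the parallelogram law makes minimising sequences Cauchy, and the derivative of the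
  energy vanishes at a minimiser. It needs \<open>qRe (m (T x))\<close> to be bounded. This holds because
  \<open>qRe (m t)\<close> is, up to signs, the sum of four values \<open>(\<phi> \<otimes> \<phi>) t\<close> for the coordinate functionals
  \<open>\<phi>\<close> of \<open>\<bbbH>\<close>, each of which the injective norm dominates (\<open>abs_qRe_mult_map_le\<close>).

  The norm equality is the Cauchy--Schwarz inequality for \<open>\<langle>\<cdot>, \<cdot>\<rangle>\<close> (\<open>norm_hinner_le\<close>), with equality
  at \<open>x = y\<close>.
\<close>

section \<open>The Riesz theorem for a real inner product\<close>

text \<open>The inner product is an explicit form rather than the one of \<^class>\<open>real_inner\<close>, so that the
  real part of a quaternionic inner product can be used; completeness refers to the given norm.\<close>

lemma real_riesz:
  fixes B :: "'a::{real_normed_vector, complete_space} \<Rightarrow> 'a \<Rightarrow> real"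
  assumes B: "bilinear B" and sym: "\<And>x y. B x y = B y x" and B_self: "\<And>x. B x x = (norm x)\<^sup>2"
    and f: "bounded_linear f"
  shows "\<exists>y. \<forall>x. B y x = f x"
proof -
  note lin [simp] = bilinear_ladd[OF B] bilinear_radd[OF B] bilinear_lmul[OF B] bilinear_rmul[OF B]
    bilinear_lsub[OF B] bilinear_rsub[OF B]
    bounded_linear.linear[OF f, THEN linear_add] bounded_linear.linear[OF f, THEN linear_scale]
  define J where "J x = (norm x)\<^sup>2 / 2 - f x" for x
  obtain K where K: "\<bar>f x\<bar> \<le> norm x * K" for x
    using bounded_linear.bounded[OF f] by auto
  have "- (K\<^sup>2 / 2) \<le> J x" for x
  proof -
    have "0 \<le> (norm x - K)\<^sup>2" by simp
    then show ?thesis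
      using K[of x] unfolding J_def power2_diff by (auto simp: abs_le_iff field_simps)
  qed
  then have bdd: "bdd_below (range J)" by (intro bdd_belowI[of _ "- (K\<^sup>2 / 2)"]) auto
  define m where "m = Inf (range J)"
  have m_le: "m \<le> J x" for x
    unfolding m_def using bdd by (simp add: cINF_lower)
  have "\<exists>x. J x < m + 1 / real (Suc n)" for n
    using cInf_lessD[of "range J" "m + 1 / real (Suc n)"] unfolding m_def[symmetric] by auto
  then obtain X where X: "J (X n) < m + 1 / real (Suc n)" for n by metis
  have parallelogram: "(norm (x - y))\<^sup>2 = 4 * (J x + J y - 2 * J ((1/2) *\<^sub>R (x + y)))" for x y
    unfolding J_def B_self[symmetric] by (simp add: sym[of y x] algebra_simps)
  have X_dist: "(norm (X i - X j))\<^sup>2 < 8 / real (Suc n)" if "n \<le> i" "n \<le> j" for i j n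
  proof -
    have "1 / real (Suc i) \<le> 1 / real (Suc n)" "1 / real (Suc j) \<le> 1 / real (Suc n)"
      using that by (simp_all add: frac_le)
    then have "J (X i) < m + 1 / real (Suc n)" "J (X j) < m + 1 / real (Suc n)"
      using X[of i] X[of j] by (meson add_left_mono order_less_le_trans)+
    then have "J (X i) + J (X j) - 2 * J ((1/2) *\<^sub>R (X i + X j)) < 2 * (1 / real (Suc n))"
      using m_le[of "(1/2) *\<^sub>R (X i + X j)"] by argo
    then show ?thesis unfolding parallelogram by simp
  qed
  have "Cauchy X"
  proof (rule CauchyI)
    fix e :: real assume "0 < e"
    obtain n where n: "8 / e\<^sup>2 < real n" using reals_Archimedean2 by blast
    have "8 / real (Suc n) < e\<^sup>2"
      using n \<open>0 < e\<close> by (simp add: field_simps) (smt (verit) zero_less_power)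
    then have "norm (X i - X j) < e" if "n \<le> i" "n \<le> j" for i j
      using X_dist[OF that] \<open>0 < e\<close> by (intro power2_less_imp_less[of _ e]) auto
    then show "\<exists>M. \<forall>i\<ge>M. \<forall>j\<ge>M. norm (X i - X j) < e" by blast
  qed
  then obtain y where "X \<longlonglongrightarrow> y"
    using Cauchy_convergent convergent_def by blast
  then have "(\<lambda>n. J (X n)) \<longlonglongrightarrow> J y"
    unfolding J_def by (intro tendsto_intros bounded_linear.tendsto[OF f]) auto
  moreover have "(\<lambda>n. m + 1 / real (Suc n)) \<longlonglongrightarrow> m"
    using tendsto_add[OF tendsto_const[of m] LIMSEQ_inverse_real_of_nat]
    by (simp add: inverse_eq_divide)
  ultimately have "J y \<le> m"
    using X by (intro LIMSEQ_le) (auto intro!: less_imp_le)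
  then have min: "J y \<le> J x" for x using m_le order_trans by blast
  have "B y x = f x" for x
  proof -
    define d where "d = B y x - f x"
    have expand: "J (y + t *\<^sub>R x) = J y + t * d + t\<^sup>2 * (norm x)\<^sup>2 / 2" for t
      unfolding J_def d_def B_self[symmetric] by (simp add: sym[of x y] power2_eq_square algebra_simps)
    \<comment> \<open>The quadratic in \<open>t\<close> is smallest at \<open>- d / (norm x)\<^sup>2\<close>; adding 1 to the denominator avoids
      the case \<open>x = 0\<close> and still gives a negative increment unless \<open>d = 0\<close>.\<close>
    define s where "s = 1 + (norm x)\<^sup>2"
    have s: "0 < s" by (simp add: s_def add_pos_nonneg)
    have "0 \<le> (- d / s) * d + (- d / s)\<^sup>2 * (norm x)\<^sup>2 / 2"
      using min[of "y + (- d / s) *\<^sub>R x"] unfolding expand by linarith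
    also have "\<dots> \<le> (- d / s) * d + (- d / s)\<^sup>2 * s / 2"
      by (simp add: s_def divide_right_mono mult_left_mono)
    also have "\<dots> = - (d\<^sup>2 / (2 * s))"
      using s by (simp add: power2_eq_square field_simps)
    finally have "d\<^sup>2 / (2 * s) \<le> 0" by simp
    then have "d\<^sup>2 \<le> 0" using s by (simp add: divide_le_0_iff)
    then show ?thesis by (simp add: d_def)
  qed
  then show ?thesis by blast
qed

section \<open>Quaternions and quaternionic inner products\<close>

text \<open>The choices \<open>\<beta> = 1, i, j, k\<close> read off the four coordinates up to sign.\<close>

lemma quat_eqI_qRe_mult:
  assumes "\<And>\<beta>. qRe (p * \<beta>) = qRe (q * \<beta>)"
  shows "p = q"
  using assms[of "Quat 1 0 0 0"] assms[of "Quat 0 1 0 0"] assms[of "Quat 0 0 1 0"]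
    assms[of "Quat 0 0 0 1"]
  by (simp add: quat_eq_iff quat_times_sel)

lemma norm_qcnj: "norm (qcnj x) = norm x"
  by (simp add: norm_quat_def)

lemma bounded_linear_quat_coordinates:
  "bounded_linear qRe" "bounded_linear qI" "bounded_linear qJ" "bounded_linear qK"
  and abs_quat_coordinate_le:
    "\<bar>qRe x\<bar> \<le> norm x" "\<bar>qI x\<bar> \<le> norm x" "\<bar>qJ x\<bar> \<le> norm x" "\<bar>qK x\<bar> \<le> norm x"
proof -
  show le: "\<bar>qRe x\<bar> \<le> norm x" "\<bar>qI x\<bar> \<le> norm x" "\<bar>qJ x\<bar> \<le> norm x" "\<bar>qK x\<bar> \<le> norm x" for x
    unfolding norm_quat_def by (intro real_le_rsqrt; simp)+
  show "bounded_linear qRe" "bounded_linear qI" "bounded_linear qJ" "bounded_linear qK"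
    by (rule bounded_linear_intro[where K = 1]; simp add: le)+
qed

lemma linear_hinner_right: "linear (hinner (y::'a::h_inner_space))"
  by (simp add: linear_iff hinner_add_right hinner_scaleR_right)

lemma norm_ract_le: "norm (x \<lhd> \<beta>) \<le> norm x * norm \<beta>" for x :: "'a::h_normed_space"
  using norm_act_le[of 1 x \<beta>] by simp

lemma bilinear_qRe_hinner: "bilinear (\<lambda>x y::'a::h_inner_space. qRe (hinner x y))"
proof -
  have "qRe (hinner x y) = qRe (hinner y x)" for x y :: 'a
    by (simp add: hinner_commute[of x y])
  then show ?thesis
    by (simp add: bilinear_def linear_iff hinner_add_right hinner_scaleR_right)
qed

text \<open>The polarisation identity turns the triangle inequality into the Cauchy--Schwarz inequality
  for the real part.\<close>

lemma qRe_hinner_le: "qRe (hinner x y) \<le> norm x * norm y" for x y :: "'a::h_inner_space"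
proof -
  have self: "qRe (hinner z z) = (norm z)\<^sup>2" for z :: 'a
    by (simp add: hinner_self del: of_real_power)
  have "(norm (x + y))\<^sup>2 = (norm x)\<^sup>2 + 2 * qRe (hinner x y) + (norm y)\<^sup>2"
    using bilinear_ladd[OF bilinear_qRe_hinner, of x y "x + y"]
    by (simp add: self[symmetric] hinner_add_right hinner_commute[of y x])
  moreover have "(norm (x + y))\<^sup>2 \<le> (norm x + norm y)\<^sup>2"
    by (simp add: norm_triangle_ineq power_mono)
  ultimately show ?thesis by (simp add: power2_sum)
qed

text \<open>Multiplying \<open>y\<close> from the right by the conjugate of \<open>\<langle>x, y\<rangle>\<close> makes the inner product real, so
  that the bound on the real part applies.\<close>

lemma norm_hinner_le: "norm (hinner x y) \<le> norm x * norm y" for x y :: "'a::h_inner_space"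
proof -
  let ?q = "hinner x y"
  have "(norm ?q)\<^sup>2 = qRe (hinner x (y \<lhd> qcnj ?q))"
    by (simp add: hinner_ract qcnj_mult_self del: of_real_power)
  also have "\<dots> \<le> norm x * norm (y \<lhd> qcnj ?q)"
    by (rule qRe_hinner_le)
  also have "\<dots> \<le> norm x * (norm y * norm ?q)"
    using norm_ract_le[of y "qcnj ?q"] by (simp add: norm_qcnj mult_left_mono)
  finally have "norm ?q * norm ?q \<le> (norm x * norm y) * norm ?q"
    by (simp add: power2_eq_square mult.assoc)
  then show ?thesis
    by (cases "norm ?q = 0") (auto simp: mult_le_cancel_right)
qed

lemma onorm_hinner: "onorm (hinner y) = norm y" for y :: "'a::h_inner_space"
proof (rule antisym)
  show "onorm (hinner y) \<le> norm y"
    by (rule onorm_bound) (auto simp: norm_hinner_le)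
  have "bounded_linear (hinner y)"
    using norm_hinner_le[of y] linear_hinner_right[of y]
    by (intro bounded_linear_intro[where K = "norm y"])
      (auto simp: linear_add linear_scale mult.commute)
  from onorm[OF this, of y] have "norm y * norm y \<le> onorm (hinner y) * norm y"
    by (simp add: hinner_self norm_power power2_eq_square norm_mult)
  then show "norm y \<le> onorm (hinner y)"
    using onorm_pos_le[OF \<open>bounded_linear (hinner y)\<close>] by (cases "y = 0") auto
qed

lemma hinner_left_cancel:
  assumes "\<And>x. hinner z x = hinner y x"
  shows "z = (y::'a::h_inner_space)"
proof -
  have "hinner x z = hinner x y" for x
    by (simp add: hinner_commute[of x] assms)
  then have "hinner (z - y) (z - y) = 0"
    by (simp add: linear_diff[OF linear_hinner_right])
  then show ?thesis using hinner_definite by fastforce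
qed

section \<open>The multiplication map\<close>

lemma linear_mult_map: "linear mult_map"
  unfolding mult_map_def
  by (rule linear_tensor_lift) (simp add: bilinear_def linear_iff distrib_left distrib_right)

lemma mult_map_ract: "mult_map (t \<lhd> \<beta>) = mult_map t * \<beta>"
proof (rule tensor_linear_eqI[where t = t])
  show "linear (\<lambda>t. mult_map (t \<lhd> \<beta>))"
    using linear_compose[OF linear_ract linear_mult_map] by (simp add: o_def)
  show "linear (\<lambda>t. mult_map t * \<beta>)"
    using linear_mult_map by (simp add: linear_iff distrib_right)
qed (simp add: ract_quat_def mult.assoc)

lemma tensor_lift_le_inj_norm:
  assumes \<phi>: "bounded_linear \<phi>" "\<And>x. \<bar>\<phi> x\<bar> \<le> norm x"
    and \<psi>: "bounded_linear \<psi>" "\<And>x. \<bar>\<psi> x\<bar> \<le> norm x"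
  shows "\<bar>tensor_lift (\<lambda>a b. \<phi> a * \<psi> b :: real) t\<bar> \<le> inj_norm t"
proof -
  have "norm (Blinfun \<phi>) \<le> 1" "norm (Blinfun \<psi>) \<le> 1"
    using \<phi> \<psi> by (auto intro!: norm_blinfun_bound simp: bounded_linear_Blinfun_apply)
  then show ?thesis
    unfolding inj_norm_def
    by (intro cSup_upper[OF _ bdd_above_inj_norm] CollectI exI[of _ "Blinfun \<phi>"]
        exI[of _ "Blinfun \<psi>"]) (simp add: bounded_linear_Blinfun_apply \<phi> \<psi>)
qed

text \<open>The real part of a product of quaternions is \<open>qRe \<cdot> qRe - qI \<cdot> qI - qJ \<cdot> qJ - qK \<cdot> qK\<close>, a signed
  sum of four products of functionals of norm at most one; hence the constant 4.\<close>

lemma abs_qRe_mult_map_le: "\<bar>qRe (mult_map t)\<bar> \<le> 4 * inj_norm t"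
proof -
  define L where "L \<phi> = tensor_lift (\<lambda>a b. \<phi> a * \<phi> b)" for \<phi> :: "quat \<Rightarrow> real"
  have bil: "bilinear (\<lambda>a b. \<phi> a * \<phi> b)" if "bounded_linear \<phi>" for \<phi> :: "quat \<Rightarrow> real"
    using bounded_linear.linear[OF that] by (simp add: bilinear_def linear_iff algebra_simps)
  note L_linear = bounded_linear_quat_coordinates[THEN bil, THEN linear_tensor_lift, folded L_def]
  have L_tensor: "L \<phi> (a \<otimes> b) = \<phi> a * \<phi> b" if "bounded_linear \<phi>" for \<phi> a b
    unfolding L_def using bil[OF that] by simp
  have "qRe (mult_map t) = L qRe t - L qI t - L qJ t - L qK t"
  proof (rule tensor_linear_eqI[where t = t])
    show "linear (\<lambda>t. qRe (mult_map t))"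
      using linear_mult_map by (simp add: linear_iff)
    show "linear (\<lambda>t. L qRe t - L qI t - L qJ t - L qK t)"
      by (intro linear_compose_sub L_linear)
  qed (simp add: L_tensor bounded_linear_quat_coordinates quat_times_sel)
  moreover have "\<bar>L qRe t\<bar> \<le> inj_norm t" "\<bar>L qI t\<bar> \<le> inj_norm t" "\<bar>L qJ t\<bar> \<le> inj_norm t"
    "\<bar>L qK t\<bar> \<le> inj_norm t"
    unfolding L_def
    by (intro tensor_lift_le_inj_norm bounded_linear_quat_coordinates abs_quat_coordinate_le)+
  ultimately show ?thesis by linarith
qed

lemma bounded_linear_qRe_mult_map:
  fixes T :: "'x::h_normed_space \<Rightarrow> (quat, quat) tensor"
  assumes "T \<in> r_dual"
  shows "bounded_linear (\<lambda>x. qRe (mult_map (T x)))"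
proof -
  obtain K where add: "\<And>x y. T (x + y) = T x + T y" and ract: "\<And>x \<alpha>. T (x \<lhd> \<alpha>) = T x \<lhd> \<alpha>"
    and K: "\<And>x. inj_norm (T x) \<le> K * norm x"
    using assms by (auto simp: r_dual_def bimodule_map_def)
  have scale: "T (r *\<^sub>R x) = r *\<^sub>R T x" for r x
    using ract[of x "of_real r"] by (simp add: ract_of_real)
  show ?thesis
  proof (rule bounded_linear_intro[where K = "4 * K"])
    fix x
    show "norm (qRe (mult_map (T x))) \<le> norm x * (4 * K)"
      using abs_qRe_mult_map_le[of "T x"] K[of x] by (simp add: algebra_simps)
  qed (simp_all add: add scale linear_add[OF linear_mult_map] linear_scale[OF linear_mult_map])
qed

section \<open>The representation theorem\<close>

theorem theorem3p12:
  fixes T :: "'y::hilbert_h_bimodule \<Rightarrow> (quat, quat) tensor"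
  assumes "T \<in> r_dual"
  shows "\<exists>y. (\<forall>x. mult_map (T x) = hinner y x) \<and> L_norm T = norm y \<and>
    (\<forall>z. (\<forall>x. mult_map (T x) = hinner z x) \<longrightarrow> z = y)"
proof -
  have "\<exists>y. \<forall>x. qRe (hinner y x) = qRe (mult_map (T x))"
  proof (rule real_riesz[OF bilinear_qRe_hinner])
    fix x y :: 'y
    show "qRe (hinner x y) = qRe (hinner y x)"
      by (simp add: hinner_commute[of x y])
    show "qRe (hinner x x) = (norm x)\<^sup>2"
      by (simp add: hinner_self del: of_real_power)
  qed (rule bounded_linear_qRe_mult_map[OF assms])
  then obtain y where y: "qRe (hinner y x) = qRe (mult_map (T x))" for x
    by blast
  have "T (x \<lhd> \<beta>) = T x \<lhd> \<beta>" for x \<beta>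
    using assms by (simp add: r_dual_def bimodule_map_def)
  then have "qRe (mult_map (T x) * \<beta>) = qRe (hinner y x * \<beta>)" for x \<beta>
    using y[of "x \<lhd> \<beta>"] by (simp add: hinner_ract mult_map_ract)
  then have rep: "mult_map (T x) = hinner y x" for x
    by (rule quat_eqI_qRe_mult)
  then have "mult_map \<circ> T = hinner y"
    by (simp add: fun_eq_iff)
  then have "L_norm T = norm y"
    by (simp add: L_norm_def onorm_hinner)
  then show ?thesis
    using rep hinner_left_cancel by metis
qed

end
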